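(* Let $p$ be a prime number, $k$ a positive integer, and $n_k\in\mathbb{N}$ such that $p^k\mid a_{n_k}$, and assume that $(a_n)_{n\in\mathbb{N}}\subset\mathbb{Z}_p$ has a pseudo-polynomial decomposition $(f_{p,j},g_{p,j})_{j\ge 2}$ modulo $p$ on $S\subset\mathbb{N}$, where $n_k\in S$. Define $$q_p(n_k)=\frac{1}{p}\left(\frac{a_{n_k+p}}{g_{p,2}(n_k+p)}-\frac{a_{n_k}}{g_{p,2}(n_k)}\right).$$ (1) If $v_p(q_p(n_k))=0$ and $S$ is dense in the set $\{n\in\mathbb{N}: n\equiv n_k\pmod{p^k}\}$ with respect to the $p$-adic metric, then there exists a unique $n_{k+1}$ modulo $p^{k+1}$ for which $n_{k+1}\equiv n_k\pmod{p^k}$ and $p^{k+1}\mid a_n$ for all $n\in S$ congruent to $n_{k+1}$ modulo $p^{k+1}$. Moreover, $n_{k+1}\equiv n_k-\frac{a_{n_k}}{g_{p,k+1}(n_k)\,q_p(n_k)}\pmod{p^{k+1}}$. (2) If $v_p(q_p(n_k))>0$ and $p^{k+1}\mid a_{n_k}$, then $p^{k+1}\mid a_n$ for all $n\in S$ satisfying $n\equiv n_k\pmod{p^k}$. (3) If $v_p(q_p(n_k))>0$ and $p^{k+1}\nmid a_{n_k}$, then $p^{k+1}\nmid a_n$ for any $n\in S$ satisfying $n\equiv n_k\pmod{p^k}$. In particular, if $k=1$, $p\mid a_{n_1}$ and $v_p(q_p(n_1))=0$, then for any positive integer $l$ there exists a unique $n_l$ modulo $p^l$ such that $n_l\equiv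 n_1\pmod p$ and $v_p(a_n)\ge l$ for all $n\in S$ congruent to $n_l$ modulo $p^l$. Moreover, $n_l$ satisfies the congruence $n_l\equiv n_{l-1}-\frac{a_{n_{l-1}}}{g_{p,l}(n_{l-1})\,q_p(n_1)}\pmod{p^l}$ for $l>1$.
   Context: $\mathbb{N}=\{0,1,2,\dots\}$; $\mathbb{Z}_p$ is the ring of $p$-adic integers and $\mathbb{Q}_p$ the field of $p$-adic numbers; $v_p$ is the $p$-adic valuation on $\mathbb{Q}_p$ with $v_p(0)=+\infty$; the $p$-adic metric is $d_p(x,y)=|x-y|_p$, where $|x|_p=p^{-v_p(x)}$ for $x\ne 0$ and $|0|_p=0$. For $x,y\in\mathbb{Q}_p$, $x\equiv y\pmod{p^k}$ means $v_p(x-y)\ge k$, and for $x\in\mathbb{Z}_p$, $p^k\mid x$ means $v_p(x)\ge k$. A pseudo-polynomial decomposition of $(a_n)_{n\in\mathbb{N}}\subset\mathbb{Z}_p$ modulo $p$ on a set $S\subset\mathbb{N}$ is a sequence of pairs $(f_{p,k},g_{p,k})_{k\ge 2}$ such that: $f_{p,k}\in\mathbb{Z}_p[X]$ and $g_{p,k}:S\to\mathbb{Z}_p\setminus p\mathbb{Z}_p$ for $k\ge2$; $a_n\equiv f_{p,k}(n)g_{p,k}(n)\pmod{p^k}$ for all $n\in S$, $k\ge2$; and $f'_{p,k}(n)\equiv f'_{p,2}(n)\pmod p$ for any $k\ge 2$ and $n\in S$, where $f'$ denotes the derivative of the polynomial $f$.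
   Formalization: The "In particular" part also assumes S is dense in {n ≡ n_1 mod p}, since otherwise uniqueness fails (e.g. a_n=n, S={0,p}, n_1=0); n_k+p ∈ S is assumed and n_{l-1} is taken in S so that the values of g are defined. *)

theory Defs
  imports
    "HOL-Analysis.Analysis"
    "HOL-Computational_Algebra.Polynomial_Factorial"
    "HOL-Number_Theory.Cong"
    "Berlekamp_Zassenhaus.Finite_Field"
begin

text \<open>The prime p is the cardinality of the type parameter. The p-adic integers are the inverse
  limit of the rings of residues modulo p^k: coherent sequences of canonical representatives.\<close>

typedef (overloaded) ('p::prime_card) padic_int =
  "{x :: nat \<Rightarrow> int. \<forall>k. x k \<in> {0..<int CARD('p) ^ k} \<and> x (Suc k) mod int CARD('p) ^ k = x k}"
  morphisms padic_residue Abs_padic_int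
  by (rule exI[of _ "\<lambda>_. 0"]) simp

setup_lifting type_definition_padic_int

lemma prime_CARD_int: "prime (int CARD('p::prime_card))"
  using prime_card[where 'a = 'p] by simp

lemma CARD_int_gt_1: "int CARD('p::prime_card) > 1"
  using prime_gt_1_int[OF prime_CARD_int[where 'p = 'p]] .

instantiation padic_int :: (prime_card) comm_ring_1
begin

lift_definition zero_padic_int :: "'a padic_int" is "\<lambda>_. 0" by simp

lift_definition one_padic_int :: "'a padic_int" is "\<lambda>k. 1 mod int CARD('a) ^ k"
  by (simp add: mod_mod_cancel)

lift_definition plus_padic_int :: "'a padic_int \<Rightarrow> 'a padic_int \<Rightarrow> 'a padic_int"
  is "\<lambda>x y k. (x k + y k) mod int CARD('a) ^ k"
proof -
  fix x y :: "nat \<Rightarrow> int" and k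
  assume "\<And>k. x k \<in> {0..<int CARD('a) ^ k} \<and> x (Suc k) mod int CARD('a) ^ k = x k"
    and "\<And>k. y k \<in> {0..<int CARD('a) ^ k} \<and> y (Suc k) mod int CARD('a) ^ k = y k"
  then show "(x k + y k) mod int CARD('a) ^ k \<in> {0..<int CARD('a) ^ k} \<and>
      (x (Suc k) + y (Suc k)) mod int CARD('a) ^ Suc k mod int CARD('a) ^ k
        = (x k + y k) mod int CARD('a) ^ k"
    using mod_add_eq[of "x (Suc k)" "int CARD('a) ^ k" "y (Suc k)"] by (simp add: mod_mod_cancel)
qed

lift_definition times_padic_int :: "'a padic_int \<Rightarrow> 'a padic_int \<Rightarrow> 'a padic_int"
  is "\<lambda>x y k. (x k * y k) mod int CARD('a) ^ k"
proof -
  fix x y :: "nat \<Rightarrow> int" and k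
  assume "\<And>k. x k \<in> {0..<int CARD('a) ^ k} \<and> x (Suc k) mod int CARD('a) ^ k = x k"
    and "\<And>k. y k \<in> {0..<int CARD('a) ^ k} \<and> y (Suc k) mod int CARD('a) ^ k = y k"
  then show "(x k * y k) mod int CARD('a) ^ k \<in> {0..<int CARD('a) ^ k} \<and>
      (x (Suc k) * y (Suc k)) mod int CARD('a) ^ Suc k mod int CARD('a) ^ k
        = (x k * y k) mod int CARD('a) ^ k"
    using mod_mult_eq[of "x (Suc k)" "int CARD('a) ^ k" "y (Suc k)"] by (simp add: mod_mod_cancel)
qed

lift_definition uminus_padic_int :: "'a padic_int \<Rightarrow> 'a padic_int"
  is "\<lambda>x k. (- x k) mod int CARD('a) ^ k"
proof -
  fix x :: "nat \<Rightarrow> int" and k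
  assume "\<And>k. x k \<in> {0..<int CARD('a) ^ k} \<and> x (Suc k) mod int CARD('a) ^ k = x k"
  then show "(- x k) mod int CARD('a) ^ k \<in> {0..<int CARD('a) ^ k} \<and>
      (- x (Suc k)) mod int CARD('a) ^ Suc k mod int CARD('a) ^ k = (- x k) mod int CARD('a) ^ k"
    using mod_minus_eq[of "x (Suc k)" "int CARD('a) ^ k"] by (simp add: mod_mod_cancel)
qed

definition minus_padic_int :: "'a padic_int \<Rightarrow> 'a padic_int \<Rightarrow> 'a padic_int"
  where "x - y = x + - y" for x y :: "'a padic_int"

instance
proof
  fix a b c :: "'a padic_int"
  show "a + b + c = a + (b + c)"
    by transfer (simp add: mod_simps add.assoc)
  show "a + b = b + a"
    by transfer (simp add: add.commute)
  show "0 + a = a"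
    by transfer (simp add: fun_eq_iff)
  show "- a + a = 0"
    by transfer (simp add: mod_simps)
  show "a - b = a + - b"
    by (simp add: minus_padic_int_def)
  show "a * b * c = a * (b * c)"
    by transfer (simp add: mod_simps mult.assoc)
  show "a * b = b * a"
    by transfer (simp add: mult.commute)
  show "1 * a = a"
    by transfer (simp add: fun_eq_iff mod_simps)
  show "(a + b) * c = a * c + b * c"
    by transfer (simp add: mod_simps distrib_right)
  show "(0::'a padic_int) \<noteq> 1"
  proof (transfer, rule notI)
    assume "(\<lambda>_. 0) = (\<lambda>k. 1 mod int CARD('a) ^ k)"
    then have "0 = 1 mod int CARD('a) ^ 1" by (rule fun_cong)
    then show False using CARD_int_gt_1[where 'p = 'a] by simp
  qed
qed

end

lemma padic_residue_bounds:
  "0 \<le> padic_residue (x :: 'p::prime_card padic_int) k"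
  "padic_residue x k < int CARD('p) ^ k"
  using padic_residue[of x] by auto

lemma padic_residue_mod:
  "i \<le> j \<Longrightarrow> padic_residue (x :: 'p::prime_card padic_int) j mod int CARD('p) ^ i = padic_residue x i"
proof (induction j rule: dec_induct)
  case base
  show ?case using padic_residue_bounds[of x i] by simp
next
  case (step j)
  have "padic_residue x (Suc j) mod int CARD('p) ^ i
      = padic_residue x (Suc j) mod int CARD('p) ^ j mod int CARD('p) ^ i"
    using step.hyps by (simp add: mod_mod_cancel le_imp_power_dvd)
  also have "padic_residue x (Suc j) mod int CARD('p) ^ j = padic_residue x j"
    using padic_residue[of x] by auto
  finally show ?case using step.IH by simp
qed

lemma padic_int_eqI: "(\<And>k. padic_residue x k = padic_residue y k) \<Longrightarrow> x = y"
  by (metis ext padic_residue_inject)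

lemma padic_residue_0 [simp]: "padic_residue 0 k = 0"
  by transfer simp

lemma padic_residue_at_0 [simp]: "padic_residue x 0 = 0"
  using padic_residue_bounds[of x 0] by simp

lemma padic_residue_of_nat:
  "padic_residue (of_nat n :: 'p::prime_card padic_int) k = int n mod int CARD('p) ^ k"
  by (induction n) (simp_all add: one_padic_int.rep_eq plus_padic_int.rep_eq mod_simps)

instance padic_int :: (prime_card) idom
proof
  fix a b :: "'a padic_int"
  assume "a \<noteq> 0" "b \<noteq> 0"
  then obtain i j where ij: "padic_residue a i \<noteq> 0" "padic_residue b j \<noteq> 0"
    by (metis padic_int_eqI padic_residue_0)
  show "a * b \<noteq> 0"
  proof
    let ?p = "int CARD('a)" and ?x = "padic_residue a (i + j)" and ?y = "padic_residue b (i + j)"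
    assume "a * b = 0"
    then have "padic_residue (a * b) (i + j) = 0" by simp
    then have "?p ^ (i + j) dvd ?x * ?y"
      by (simp add: times_padic_int.rep_eq mod_eq_0_iff_dvd)
    then have "?p ^ i dvd ?x \<or> ?p ^ j dvd ?y"
      using prime_elem_power_dvd_prod[of ?p "i + j" ?x ?y] prime_CARD_int[where 'p = 'a]
      by (metis add_less_mono linorder_not_le nat_neq_iff power_le_dvd prime_imp_prime_elem)
    then show False
      using ij padic_residue_mod[of i "i + j" a] padic_residue_mod[of j "i + j" b]
      by (auto simp: mod_eq_0_iff_dvd)
  qed
qed

lemma padic_residue_p_mult:
  "padic_residue (of_nat CARD('p) * x :: 'p::prime_card padic_int) (Suc k)
    = int CARD('p) * padic_residue x k"
proof -
  let ?p = "int CARD('p)"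
  have "padic_residue (of_nat CARD('p) * x) (Suc k) = ?p * padic_residue x (Suc k) mod ?p ^ Suc k"
    by (simp add: times_padic_int.rep_eq padic_residue_of_nat mod_simps)
  also have "\<dots> = ?p * (padic_residue x (Suc k) mod ?p ^ k)"
    by (simp only: mult_mod_right power_Suc)
  finally show ?thesis by (simp add: padic_residue_mod)
qed

lemma p_dvd_padic_int_iff:
  "of_nat CARD('p) dvd (x :: 'p::prime_card padic_int) \<longleftrightarrow> padic_residue x 1 = 0"
proof
  assume "of_nat CARD('p) dvd x"
  then show "padic_residue x 1 = 0"
    by (auto simp: padic_residue_p_mult elim!: dvdE)
next
  let ?p = "int CARD('p)"
  assume x1: "padic_residue x 1 = 0"
  have p0: "?p > 0" using CARD_int_gt_1[where 'p = 'p] by simp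
  define y where "y k = padic_residue x (Suc k) div ?p" for k
  have py: "?p * y k = padic_residue x (Suc k)" for k
    using padic_residue_mod[of 1 "Suc k" x] x1 by (simp add: y_def mod_eq_0_iff_dvd)
  have "?p * (y (Suc k) mod ?p ^ k) = ?p * y k" for k
    using padic_residue_mod[of "Suc k" "Suc (Suc k)" x]
    by (simp only: mult_mod_right py power_Suc[symmetric])
  then have "y (Suc k) mod ?p ^ k = y k" for k
    using p0 by simp
  moreover have "0 \<le> y k \<and> y k < ?p ^ k" for k
  proof -
    have "0 \<le> ?p * y k" "?p * y k < ?p * ?p ^ k"
      using padic_residue_bounds[of x "Suc k"] by (simp_all add: py)
    then show ?thesis using p0 by (simp add: zero_le_mult_iff)
  qed
  ultimately have "padic_residue (Abs_padic_int y :: 'p padic_int) = y"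
    by (intro Abs_padic_int_inverse CollectI allI conjI) simp_all
  then obtain z :: "'p padic_int" where z: "padic_residue z = y" ..
  have "x = of_nat CARD('p) * z"
  proof (rule padic_int_eqI)
    fix k
    show "padic_residue x k = padic_residue (of_nat CARD('p) * z) k"
      by (cases k) (simp_all add: padic_residue_p_mult z py)
  qed
  then show "of_nat CARD('p) dvd x" by simp
qed

lemma padic_int_unit_iff:
  "(x :: 'p::prime_card padic_int) dvd 1 \<longleftrightarrow> \<not> of_nat CARD('p) dvd x"
proof
  assume "x dvd 1"
  show "\<not> of_nat CARD('p) dvd x"
  proof
    assume "of_nat CARD('p) dvd x"
    then have "of_nat CARD('p) dvd (1 :: 'p padic_int)"
      using \<open>x dvd 1\<close> by (rule dvd_trans)
    then show False
      using CARD_int_gt_1[where 'p = 'p]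
      by (simp add: p_dvd_padic_int_iff one_padic_int.rep_eq)
  qed
next
  let ?p = "int CARD('p)"
  assume "\<not> of_nat CARD('p) dvd x"
  then have x1: "padic_residue x 1 \<noteq> 0" by (simp add: p_dvd_padic_int_iff)
  have "\<exists>y. [padic_residue x k * y = 1] (mod ?p ^ k)" for k
  proof (cases k)
    case 0
    then show ?thesis by simp
  next
    case (Suc j)
    have "\<not> ?p dvd padic_residue x k"
      using x1 padic_residue_mod[of 1 k x] Suc by (auto simp: mod_eq_0_iff_dvd)
    then have "coprime ?p (padic_residue x k)"
      using prime_CARD_int[where 'p = 'p] by (rule prime_imp_coprime[rotated])
    then show ?thesis
      by (intro cong_solve_coprime_int) (simp add: coprime_commute)
  qed
  then obtain y where y: "[padic_residue x k * y k = 1] (mod ?p ^ k)" for k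
    by metis
  define z where "z k = y k mod ?p ^ k" for k
  have z: "[padic_residue x k * z k = 1] (mod ?p ^ k)" for k
    using y[of k] by (simp add: cong_def z_def mod_simps)
  have "z (Suc k) mod ?p ^ k = z k" for k
  proof -
    have "[padic_residue x (Suc k) * z (Suc k) = 1] (mod ?p ^ k)"
      using z[of "Suc k"] by (rule cong_dvd_modulus) simp
    moreover have "[padic_residue x k = padic_residue x (Suc k)] (mod ?p ^ k)"
      using padic_residue_mod[of k "Suc k" x] padic_residue_mod[of k k x] by (simp add: cong_def)
    ultimately have *: "[padic_residue x k * z (Suc k) = 1] (mod ?p ^ k)"
      by (metis cong_scalar_right cong_trans)
    have "[z (Suc k) = (padic_residue x k * z k) * z (Suc k)] (mod ?p ^ k)"
      using cong_scalar_right[OF cong_sym[OF z[of k]], of "z (Suc k)"] by simp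
    also have "[(padic_residue x k * z k) * z (Suc k) = z k] (mod ?p ^ k)"
      using cong_scalar_right[OF *, of "z k"] by (simp add: mult_ac)
    finally show ?thesis by (simp add: cong_def z_def)
  qed
  moreover have "0 \<le> z k \<and> z k < ?p ^ k" for k
    using CARD_int_gt_1[where 'p = 'p] by (simp add: z_def)
  ultimately have "padic_residue (Abs_padic_int z :: 'p padic_int) = z"
    by (intro Abs_padic_int_inverse CollectI allI conjI) simp_all
  then obtain w :: "'p padic_int" where w: "padic_residue w = z" ..
  have "x * w = 1"
    using z by (intro padic_int_eqI)
      (simp add: times_padic_int.rep_eq one_padic_int.rep_eq w cong_def)
  then show "x dvd 1" by (rule dvdI[OF sym])
qed

lemma padic_int_decomp:
  assumes "(x :: 'p::prime_card padic_int) \<noteq> 0"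
  obtains n u where "u dvd 1" "x = of_nat CARD('p) ^ n * u"
proof -
  obtain m where "padic_residue x m \<noteq> 0"
    using assms by (metis padic_int_eqI padic_residue_0)
  then have "\<exists>n u. u dvd 1 \<and> x = of_nat CARD('p) ^ n * u"
  proof (induction m arbitrary: x)
    case 0
    then show ?case by simp
  next
    case (Suc m)
    show ?case
    proof (cases "of_nat CARD('p) dvd x")
      case True
      then obtain y where y: "x = of_nat CARD('p) * y" ..
      with Suc.prems have "padic_residue y m \<noteq> 0" by (auto simp: padic_residue_p_mult)
      from Suc.IH[OF this] obtain n u where "u dvd 1" "y = of_nat CARD('p) ^ n * u" by blast
      with y have "u dvd 1 \<and> x = of_nat CARD('p) ^ Suc n * u" by (simp add: mult_ac)
      then show ?thesis by blast
    next
      case False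
      then have "x dvd 1 \<and> x = of_nat CARD('p) ^ 0 * x" by (simp add: padic_int_unit_iff)
      then show ?thesis by blast
    qed
  qed
  then show thesis using that by blast
qed

lemma of_nat_CARD_padic_int_neq_0 [simp]: "of_nat CARD('p) \<noteq> (0 :: 'p::prime_card padic_int)"
proof
  assume "of_nat CARD('p) = (0 :: 'p padic_int)"
  then have "padic_residue (of_nat CARD('p) :: 'p padic_int) 2 = 0" by simp
  then show False
    using CARD_int_gt_1[where 'p = 'p]
    by (simp add: padic_residue_of_nat power2_eq_square mod_mult_self1_is_0)
qed

type_synonym 'p padic = "'p padic_int fract"

lemma to_fract_of_nat [simp]: "to_fract (of_nat n) = of_nat n"
  by (induction n) simp_all

lemma to_fract_power: "to_fract (x ^ n) = to_fract x ^ n"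
  by (induction n) simp_all

text \<open>The valuation of a nonzero x is the unique integer m such that x is p^m times a unit of
  the ring of p-adic integers; see \<open>padic_decomp\<close> and \<open>padic_val_eqI\<close> below.\<close>

definition padic_val :: "'p::prime_card padic \<Rightarrow> ereal" where
  "padic_val x = (if x = 0 then \<infinity> else
     ereal (of_int (THE m. \<exists>u. u dvd 1 \<and> x = of_nat CARD('p) powi m * to_fract u)))"

definition padic_abs :: "'p::prime_card padic \<Rightarrow> real" where
  "padic_abs x = (if x = 0 then 0 else real CARD('p) powr (- real_of_ereal (padic_val x)))"

definition padic_dist :: "'p::prime_card padic \<Rightarrow> 'p padic \<Rightarrow> real" where
  "padic_dist x y = padic_abs (x - y)"

definition padic_cong :: "'p::prime_card padic \<Rightarrow> 'p padic \<Rightarrow> nat \<Rightarrow> bool" where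
  "padic_cong x y k \<longleftrightarrow> ereal (real k) \<le> padic_val (x - y)"

abbreviation padic_topology :: "'p::prime_card padic topology" where
  "padic_topology \<equiv> Metric_space.mtopology UNIV padic_dist"

lemma of_nat_CARD_padic_neq_0 [simp]: "of_nat CARD('p) \<noteq> (0 :: 'p::prime_card padic)"
  by (metis of_nat_CARD_padic_int_neq_0 to_fract_eq_0_iff to_fract_of_nat)

lemma padic_decomp:
  assumes "(x :: 'p::prime_card padic) \<noteq> 0"
  obtains m u where "u dvd 1" "x = of_nat CARD('p) powi m * to_fract u"
proof -
  obtain a b where ab: "x = Fract a b" "b \<noteq> 0" by (cases x)
  with assms have "a \<noteq> 0" by (auto simp: fract_collapse)
  obtain i u where u: "u dvd 1" "a = of_nat CARD('p) ^ i * u"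
    using padic_int_decomp[OF \<open>a \<noteq> 0\<close>] .
  obtain j v where v: "v dvd 1" "b = of_nat CARD('p) ^ j * v"
    using padic_int_decomp[OF \<open>b \<noteq> 0\<close>] .
  obtain w where w: "1 = v * w" using v(1) ..
  then have "to_fract v * to_fract w = 1" by (metis to_fract_1 to_fract_mult)
  then have "to_fract w = inverse (to_fract v)" by (metis inverse_unique)
  moreover have "x = to_fract a / to_fract b" by (simp add: ab to_fract_def)
  ultimately have "x = of_nat CARD('p) powi (int i - int j) * to_fract (u * w)"
    by (simp add: u v power_int_diff to_fract_power field_simps)
  moreover have "u * w dvd 1" using u(1) w by (metis dvd_triv_right mult_dvd_mono mult_1)
  ultimately show thesis using that by blast
qed

lemma padic_decomp_unique_aux:
  assumes "u dvd 1" "v dvd 1" "m \<le> n"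
    and "of_nat CARD('p) powi m * to_fract u
      = (of_nat CARD('p) powi n * to_fract v :: 'p::prime_card padic)"
  shows "m = n"
proof (rule ccontr)
  assume "m \<noteq> n"
  then obtain d where d: "n = m + int (Suc d)"
    using \<open>m \<le> n\<close> by (metis zless_iff_Suc_zadd less_le)
  have "to_fract u = to_fract (of_nat CARD('p) ^ Suc d * v)"
    using assms(4) by (simp add: d power_int_add to_fract_power del: of_nat_Suc)
  then have "u = of_nat CARD('p) ^ Suc d * v" by (simp only: to_fract_eq_iff)
  then have "of_nat CARD('p) dvd u" by simp
  then show False using assms(1) by (simp add: padic_int_unit_iff)
qed

lemma padic_val_eqI:
  assumes "u dvd 1" "x = of_nat CARD('p) powi m * to_fract u"
  shows "padic_val (x :: 'p::prime_card padic) = ereal (of_int m)"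
proof -
  have "u \<noteq> 0" using assms(1) by auto
  then have "x \<noteq> 0" using assms(2) by simp
  moreover have "(THE m. \<exists>u. u dvd 1 \<and> x = of_nat CARD('p) powi m * to_fract u) = m"
    using assms by (intro the_equality) (metis padic_decomp_unique_aux linorder_linear)+
  ultimately show ?thesis by (simp add: padic_val_def)
qed

lemma padic_val_mult:
  "padic_val (x * y :: 'p::prime_card padic) = padic_val x + padic_val y"
proof (cases "x = 0 \<or> y = 0")
  case True
  then show ?thesis by (auto simp: padic_val_def)
next
  case False
  then obtain m u n v where
    x: "u dvd 1" "x = of_nat CARD('p) powi m * to_fract u" and
    y: "v dvd 1" "y = of_nat CARD('p) powi n * to_fract v"
    by (metis padic_decomp)
  have "u * v dvd 1" using x(1) y(1) by (metis mult_dvd_mono mult_1)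
  moreover have "x * y = of_nat CARD('p) powi (m + n) * to_fract (u * v)"
    by (simp add: x y power_int_add)
  ultimately show ?thesis
    using padic_val_eqI[OF x] padic_val_eqI[OF y] padic_val_eqI by (metis of_int_add plus_ereal.simps(1))
qed

lemma padic_val_to_fract_ge_iff:
  "ereal (real k) \<le> padic_val (to_fract (x :: 'p::prime_card padic_int))
    \<longleftrightarrow> of_nat CARD('p) ^ k dvd x"
proof (cases "x = 0")
  case True
  then show ?thesis by (simp add: padic_val_def)
next
  case False
  then obtain n u where u: "u dvd 1" and x: "x = of_nat CARD('p) ^ n * u"
    by (metis padic_int_decomp)
  have "padic_val (to_fract x) = ereal (of_int (int n))"
    using u by (rule padic_val_eqI) (simp add: x to_fract_power)
  moreover have "k \<le> n" if "of_nat CARD('p) ^ k dvd x"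
  proof (rule ccontr)
    assume "\<not> k \<le> n"
    then obtain d where d: "k = n + Suc d" by (metis add_Suc_right less_imp_Suc_add not_le)
    then have "of_nat CARD('p) ^ n * of_nat CARD('p) ^ Suc d dvd of_nat CARD('p) ^ n * u"
      using that x by (simp only: power_add)
    then have "of_nat CARD('p) ^ Suc d dvd u" by simp
    then have "of_nat CARD('p) dvd u" unfolding power_Suc by (rule dvd_mult_left)
    then show False using u by (simp add: padic_int_unit_iff)
  qed
  moreover have "of_nat CARD('p) ^ k dvd x" if "k \<le> n"
    using that by (simp add: x le_imp_power_dvd dvd_mult2)
  ultimately show ?thesis by auto
qed

lemma padic_val_uminus: "padic_val (- x :: 'p::prime_card padic) = padic_val x"
proof -
  have "padic_val (- 1 :: 'p padic) = ereal (of_int 0)"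
    by (rule padic_val_eqI[of "- 1"]) (simp_all add: to_fract_uminus)
  then show ?thesis using padic_val_mult[of "- 1" x] by simp
qed

lemma padic_val_add_ge:
  "min (padic_val x) (padic_val y) \<le> padic_val (x + y :: 'p::prime_card padic)"
proof -
  have *: "padic_val x \<le> padic_val (x + y)"
    if le: "padic_val x \<le> padic_val y" and nz: "x \<noteq> 0" "y \<noteq> 0" for x y :: "'p padic"
  proof -
    obtain m u n v where
      x: "u dvd 1" "x = of_nat CARD('p) powi m * to_fract u" and
      y: "v dvd 1" "y = of_nat CARD('p) powi n * to_fract v"
      using nz by (metis padic_decomp)
    have "m \<le> n" using le padic_val_eqI[OF x] padic_val_eqI[OF y] by simp
    then obtain d where d: "n = m + int d" by (metis zle_iff_zadd)
    let ?w = "u + of_nat CARD('p) ^ d * v"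
    have "x + y = of_nat CARD('p) powi m * to_fract ?w"
      by (simp add: x y d power_int_add to_fract_power algebra_simps)
    moreover have "padic_val (of_nat CARD('p) powi m :: 'p padic) = ereal (of_int m)"
      by (rule padic_val_eqI[of 1]) simp_all
    moreover have "0 \<le> padic_val (to_fract ?w)"
      using padic_val_to_fract_ge_iff[of 0 ?w] by (simp add: zero_ereal_def)
    ultimately show ?thesis
      using padic_val_eqI[OF x] by (simp add: padic_val_mult ereal_le_add_self)
  qed
  show ?thesis
  proof (cases "x = 0 \<or> y = 0")
    case True
    then show ?thesis by auto
  next
    case False
    then show ?thesis
      using *[of x y] *[of y x] by (auto simp: min_def add.commute)
  qed
qed

lemma padic_abs_add_le:
  "padic_abs (x + y :: 'p::prime_card padic) \<le> max (padic_abs x) (padic_abs y)"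
proof (cases "x = 0 \<or> y = 0 \<or> x + y = 0")
  case True
  then show ?thesis by (auto simp: padic_abs_def le_max_iff_disj)
next
  case False
  have fin: "\<exists>m. padic_val z = ereal (of_int m)" if "z \<noteq> 0" for z :: "'p padic"
    using that by (simp add: padic_val_def)
  obtain i j l where v: "padic_val x = ereal (of_int i)" "padic_val y = ereal (of_int j)"
    "padic_val (x + y) = ereal (of_int l)"
    using fin[of x] fin[of y] fin[of "x + y"] False by blast
  have "min i j \<le> l" using padic_val_add_ge[of x y] by (auto simp: v min_def split: if_splits)
  moreover have "real CARD('p) > 1" using CARD_int_gt_1[where 'p = 'p] by linarith
  ultimately show ?thesis
    using False by (auto simp: padic_abs_def v min_def max_def split: if_splits)
qed

lemma Metric_space_padic_dist: "Metric_space UNIV (padic_dist :: 'p::prime_card padic \<Rightarrow> _)"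
proof
  fix x y z :: "'p padic"
  have nonneg: "0 \<le> padic_abs w" for w :: "'p padic"
    by (simp add: padic_abs_def)
  show "0 \<le> padic_dist x y" by (simp add: padic_dist_def nonneg)
  show "padic_dist x y = padic_dist y x"
    using padic_val_uminus[of "x - y"] by (simp add: padic_dist_def padic_abs_def)
  show "padic_dist x y = 0 \<longleftrightarrow> x = y" by (simp add: padic_dist_def padic_abs_def)
  show "padic_dist x z \<le> padic_dist x y + padic_dist y z"
    using padic_abs_add_le[of "x - y" "y - z"] nonneg[of "x - y"] nonneg[of "y - z"]
    by (simp add: padic_dist_def)
qed

text \<open>Only the entries \<open>f j\<close> and \<open>g j n\<close> with \<open>j \<ge> 2\<close> and \<open>n \<in> S\<close> matter.\<close>

definition pseudo_poly_decomposition ::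
  "(nat \<Rightarrow> 'p::prime_card padic_int) \<Rightarrow> nat set \<Rightarrow>
   (nat \<Rightarrow> 'p padic_int poly) \<Rightarrow> (nat \<Rightarrow> nat \<Rightarrow> 'p padic_int) \<Rightarrow> bool" where
  "pseudo_poly_decomposition a S f g \<longleftrightarrow>
     (\<forall>j\<ge>2. \<forall>n\<in>S. \<not> of_nat CARD('p) dvd g j n) \<and>
     (\<forall>j\<ge>2. \<forall>n\<in>S. padic_cong (to_fract (a n)) (to_fract (poly (f j) (of_nat n) * g j n)) j) \<and>
     (\<forall>j\<ge>2. \<forall>n\<in>S. padic_cong (to_fract (poly (pderiv (f j)) (of_nat n)))
                              (to_fract (poly (pderiv (f 2)) (of_nat n))) 1)"

definition is_lift ::
  "(nat \<Rightarrow> 'p::prime_card padic_int) \<Rightarrow> nat set \<Rightarrow> nat \<Rightarrow> nat \<Rightarrow> nat \<Rightarrow> nat \<Rightarrow> bool" where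
  "is_lift a S n0 k l m \<longleftrightarrow>
     [m = n0] (mod CARD('p) ^ k) \<and>
     (\<forall>n\<in>S. [n = m] (mod CARD('p) ^ l) \<longrightarrow> ereal (real l) \<le> padic_val (to_fract (a n)))"

end

theory Submission
  imports Defs
begin

text \<open>Taylor expansion of \<open>f 2\<close> modulo \<open>p\<^sup>2\<close> shows that \<open>q\<close> is a p-adic integer congruent to the
  derivative of \<open>f 2\<close> at \<open>n\<^sub>k\<close> modulo p, hence to the derivative of every \<open>f j\<close> at every \<open>n \<in> S\<close>
  in the class of \<open>n\<^sub>k\<close> modulo p. Since \<open>2 k \<ge> k + 1\<close>, the values of \<open>f (k + 1)\<close> on the class of n modulo
  \<open>p ^ k\<close> are given modulo \<open>p ^ (k + 1)\<close> by \<open>f (k + 1) n + q (s - n)\<close>. If p divides q, they are all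
  equal; if q is a unit, they vanish on exactly one class modulo \<open>p ^ (k + 1)\<close>, the Newton iterate
  of n. Density is needed only so that every class contains an element of S; otherwise a class
  disjoint from S would be a lift vacuously.\<close>

section \<open>Taylor expansion and divisibility in commutative rings\<close>

lemma second_order_taylor_poly:
  fixes f :: "'a::idom poly"
  shows "h\<^sup>2 dvd poly f (x + h) - poly f x - h * poly (pderiv f) x"
proof (induction f)
  case 0
  show ?case by simp
next
  case (pCons c f)
  \<comment> \<open>The remainder for \<open>pCons c f\<close> is \<open>x + h\<close> times the
    remainder for \<open>f\<close> plus a multiple of the square of \<open>h\<close>. No division by
    2 occurs, so the case p = 2 needs no special care.\<close>
  have "poly (pCons c f) (x + h) - poly (pCons c f) x - h * poly (pderiv (pCons c f)) x
      = (x + h) * (poly f (x + h) - poly f x - h * poly (pderiv f) x)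
        + h\<^sup>2 * poly (pderiv f) x"
    by (simp add: pderiv_pCons algebra_simps power2_eq_square)
  then show ?case using pCons.IH by simp
qed

lemma dvd_poly_diff:
  fixes f :: "'a::idom poly"
  shows "x - y dvd poly f x - poly f y"
proof -
  have "x - y dvd (x - y)\<^sup>2" by (simp add: power2_eq_square)
  also have "\<dots> dvd poly f (y + (x - y)) - poly f y - (x - y) * poly (pderiv f) y"
    by (rule second_order_taylor_poly)
  finally have "x - y dvd poly f x - poly f y - (x - y) * poly (pderiv f) y" by simp
  from dvd_add[OF this dvd_triv_left[of "x - y" "poly (pderiv f) y"]] show ?thesis by simp
qed

lemma dvd_mult_unit_cancel:
  fixes d x u :: "'a::comm_ring_1"
  assumes "u dvd 1"
  shows "d dvd x * u \<longleftrightarrow> d dvd x"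
proof
  obtain w where w: "1 = u * w" using assms ..
  assume "d dvd x * u"
  then have "d dvd x * (u * w)" by (metis dvd_mult2 mult.assoc)
  then show "d dvd x" by (simp flip: w)
qed simp

lemma dvd_diff_cong:
  fixes d x y :: "'a::comm_ring_1"
  assumes "d dvd x - y"
  shows "d dvd x \<longleftrightarrow> d dvd y"
proof
  assume "d dvd x"
  from dvd_diff[OF this assms] show "d dvd y" by simp
next
  assume "d dvd y"
  from dvd_add[OF assms this] show "d dvd x" by simp
qed

lemma dvd_diff_swap:
  fixes d x y :: "'a::comm_ring_1"
  shows "d dvd x - y \<longleftrightarrow> d dvd y - x"
  using dvd_minus_iff[of d "x - y"] by simp

section \<open>Divisibility by powers of the uniformizer p in the p-adic integers\<close>

abbreviation unif :: "'p::prime_card padic_int" where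
  "unif \<equiv> of_nat CARD('p)"

lemma padic_residue_eq_0_if_dvd:
  assumes "unif ^ k dvd (x :: 'p::prime_card padic_int)"
  shows "padic_residue x k = 0"
proof -
  obtain y where "x = of_nat (CARD('p) ^ k) * y" using assms by (auto elim: dvdE)
  then show ?thesis
    by (simp add: times_padic_int.rep_eq padic_residue_of_nat mod_mult_left_eq del: of_nat_power)
       (simp add: mod_mult_left_eq)
qed

lemma unif_power_dvd_of_nat_iff:
  "unif ^ k dvd (of_nat n :: 'p::prime_card padic_int) \<longleftrightarrow> CARD('p) ^ k dvd n"
proof
  assume "unif ^ k dvd (of_nat n :: 'p padic_int)"
  then have "int n mod int (CARD('p) ^ k) = 0"
    using padic_residue_eq_0_if_dvd[of k "of_nat n :: 'p padic_int"]
    by (simp add: padic_residue_of_nat)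
  then show "CARD('p) ^ k dvd n"
    by (metis mod_eq_0_iff_dvd of_nat_dvd_iff)
qed (auto elim!: dvdE)

text \<open>Moves congruences of naturals into the ring of p-adic integers, where all later
  arguments take place. Ordering \<open>n\<close> and \<open>m\<close> first avoids truncated
  subtraction.\<close>

lemma cong_iff_unif_power_dvd:
  "[n = m] (mod CARD('p) ^ k) \<longleftrightarrow> unif ^ k dvd (of_nat n - of_nat m :: 'p::prime_card padic_int)"
proof (induction n m rule: linorder_wlog)
  case (le n m)
  have "[n = m] (mod CARD('p) ^ k) \<longleftrightarrow> CARD('p) ^ k dvd m - n"
    using cong_altdef_nat[OF le] by (simp add: cong_sym_eq)
  also have "\<dots> \<longleftrightarrow> unif ^ k dvd (of_nat m - of_nat n :: 'p padic_int)"
    using le by (simp add: of_nat_diff flip: unif_power_dvd_of_nat_iff[where 'p = 'p])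
  finally show ?case using dvd_diff_swap by blast
next
  case (sym n m)
  then show ?case by (simp add: cong_sym_eq dvd_diff_swap)
qed

lemma padic_residue_diff:
  "padic_residue (x - y :: 'p::prime_card padic_int) k
    = (padic_residue x k - padic_residue y k) mod int CARD('p) ^ k"
  unfolding minus_padic_int_def plus_padic_int.rep_eq uminus_padic_int.rep_eq mod_add_right_eq
  by simp

text \<open>Digits are stripped one at a time: \<open>x\<close> minus its first residue is divisible
  by p, and the quotient is approximated to one digit less. This turns a Newton iterate, a p-adic
  integer, into a natural number.\<close>

lemma padic_int_approx_nat:
  obtains m where "unif ^ k dvd (x - of_nat m :: 'p::prime_card padic_int)"
proof -
  have "\<exists>m. unif ^ k dvd (x - of_nat m)"
  proof (induction k arbitrary: x)
    case 0
    show ?case by simp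
  next
    case (Suc k)
    define r where "r = nat (padic_residue x 1)"
    have "int r = padic_residue x 1"
      using padic_residue_bounds(1)[of x 1] unfolding r_def by (rule int_nat_eq[THEN trans, OF if_P])
    then have "padic_residue (of_nat r :: 'p padic_int) 1 = padic_residue x 1"
      using padic_residue_mod[of 1 1 x] by (simp only: padic_residue_of_nat)
    then have "padic_residue (x - of_nat r) 1 = 0"
      unfolding padic_residue_diff by simp
    then obtain y where y: "x - of_nat r = unif * y"
      using p_dvd_padic_int_iff by (auto elim: dvdE)
    obtain m where "unif ^ k dvd y - of_nat m" using Suc.IH by blast
    then have "unif ^ Suc k dvd unif * (y - of_nat m)" by simp
    also have "unif * (y - of_nat m) = x - of_nat (r + CARD('p) * m)"
      using y by (simp add: algebra_simps)
    finally show ?case by blast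
  qed
  with that show thesis by blast
qed

section \<open>Valuations and p-adic density in terms of divisibility\<close>

lemma padic_cong_to_fract_iff:
  "padic_cong (to_fract x) (to_fract y) k \<longleftrightarrow> unif ^ k dvd (x - y :: 'p::prime_card padic_int)"
  unfolding padic_cong_def to_fract_diff[symmetric] by (rule padic_val_to_fract_ge_iff)

text \<open>Integrality of the valuation enters here: for \<open>x\<close> equal to
  \<open>unif ^ n\<close> times a unit, being positive means that \<open>n\<close> is at least
  1.\<close>

lemma padic_val_to_fract_pos_iff:
  "0 < padic_val (to_fract x) \<longleftrightarrow> unif dvd (x :: 'p::prime_card padic_int)"
proof (cases "x = 0")
  case True
  then show ?thesis by (simp add: padic_val_def)
next
  case False
  then obtain n u where u: "u dvd 1" "x = unif ^ n * u" by (metis padic_int_decomp)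
  have "padic_val (to_fract x) = ereal (of_int (int n))"
    using u by (intro padic_val_eqI) (simp_all add: to_fract_power)
  moreover have "unif dvd x \<longleftrightarrow> 0 < n"
    using u by (cases n) (auto simp: padic_int_unit_iff)
  ultimately show ?thesis by simp
qed

lemma padic_val_to_fract_eq_0_iff:
  "padic_val (to_fract x) = 0 \<longleftrightarrow> (x :: 'p::prime_card padic_int) dvd 1"
  using padic_val_to_fract_pos_iff[of x] padic_val_to_fract_ge_iff[of 0 x]
  by (auto simp: padic_int_unit_iff order_less_le zero_ereal_def)

text \<open>The ball of radius p to the power -k around \<open>n\<close> meets the image of
  \<open>S\<close>, and a distance below that radius forces valuation above
  \<open>k\<close>.\<close>

lemma padic_closure_of_approx:
  assumes "(of_nat n :: 'p::prime_card padic) \<in> padic_topology closure_of (of_nat ` S)"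
  obtains s where "s \<in> S" "[s = n] (mod CARD('p) ^ k)"
proof -
  interpret Metric_space UNIV "padic_dist :: 'p padic \<Rightarrow> _" by (rule Metric_space_padic_dist)
  have p1: "real CARD('p) > 1" using CARD_int_gt_1[where 'p = 'p] by linarith
  then have "real CARD('p) powr (- real k) > 0" by simp
  then obtain s where s: "s \<in> S"
    and d: "padic_dist (of_nat n :: 'p padic) (of_nat s) < real CARD('p) powr (- real k)"
    using assms unfolding metric_closure_of mem_Collect_eq in_mball by blast
  let ?z = "of_nat n - of_nat s :: 'p padic_int"
  have eq: "of_nat n - of_nat s = to_fract ?z" by (simp add: to_fract_diff)
  have "ereal (real k) \<le> padic_val (to_fract ?z)"
  proof (cases "?z = 0")
    case True
    then show ?thesis by (simp add: padic_val_def)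
  next
    case False
    obtain m where m: "padic_val (to_fract ?z) = ereal (of_int m)"
      using False unfolding padic_val_def to_fract_eq_0_iff by auto
    have "real CARD('p) powr (- of_int m) < real CARD('p) powr (- real k)"
      using d False m unfolding padic_dist_def eq padic_abs_def to_fract_eq_0_iff
      by (simp del: to_fract_diff)
    then show ?thesis using p1 m by simp
  qed
  then have "unif ^ k dvd ?z" by (rule padic_val_to_fract_ge_iff[THEN iffD1])
  then have "[s = n] (mod CARD('p) ^ k)"
    using dvd_diff_swap unfolding cong_iff_unif_power_dvd[where 'p = 'p] by blast
  with s that show thesis by blast
qed

section \<open>Consequences of a pseudo-polynomial decomposition\<close>

locale pseudo_poly =
  fixes a :: "nat \<Rightarrow> 'p::prime_card padic_int" and S f g
  assumes decomp: "pseudo_poly_decomposition a S f g"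
begin

lemma g_unit: "j \<ge> 2 \<Longrightarrow> n \<in> S \<Longrightarrow> g j n dvd 1"
  using decomp by (simp add: pseudo_poly_decomposition_def padic_int_unit_iff)

lemma a_cong: "j \<ge> 2 \<Longrightarrow> n \<in> S \<Longrightarrow> unif ^ j dvd a n - poly (f j) (of_nat n) * g j n"
  using decomp unfolding pseudo_poly_decomposition_def padic_cong_to_fract_iff by blast

text \<open>First \<open>f j\<close> is exchanged for \<open>f 2\<close> at the same point, by the
  decomposition; then the point moves within its class modulo p, since \<open>pderiv (f 2)\<close>
  is a polynomial.\<close>

lemma pderiv_cong:
  assumes "j \<ge> 2" "n \<in> S" "unif dvd (of_nat n - of_nat n' :: 'p padic_int)"
  shows "unif dvd poly (pderiv (f j)) (of_nat n) - poly (pderiv (f 2)) (of_nat n')"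
proof -
  have "unif ^ 1 dvd poly (pderiv (f j)) (of_nat n) - poly (pderiv (f 2)) (of_nat n)"
    using decomp assms unfolding pseudo_poly_decomposition_def padic_cong_to_fract_iff by blast
  moreover have "unif dvd poly (pderiv (f 2)) (of_nat n) - poly (pderiv (f 2)) (of_nat n')"
    using assms(3) dvd_poly_diff by (rule dvd_trans)
  ultimately show ?thesis unfolding power_one_right
    by (metis (no_types) diff_add_cancel add_diff_eq dvd_add)
qed

lemma dvd_a_iff:
  assumes "j \<ge> 2" "n \<in> S" "i \<le> j"
  shows "unif ^ i dvd a n \<longleftrightarrow> unif ^ i dvd poly (f j) (of_nat n)"
proof -
  have "unif ^ i dvd a n - poly (f j) (of_nat n) * g j n"
    using a_cong[OF assms(1,2)] assms(3) by (meson dvd_trans le_imp_power_dvd)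
  then show ?thesis
    using dvd_diff_cong dvd_mult_unit_cancel[OF g_unit[OF assms(1,2)]] by blast
qed

text \<open>With h = s - n, the Taylor remainder is divisible by \<open>unif ^ (2 * k)\<close>, and
  exchanging the derivative for \<open>c\<close> costs h times a multiple of p. The slope
  \<open>c\<close> is left free: it is later the value of q or 0.\<close>

lemma linear_approx:
  assumes "k \<ge> 1" "n \<in> S" "unif ^ k dvd (of_nat s - of_nat n :: 'p padic_int)"
    and "unif dvd poly (pderiv (f 2)) (of_nat n) - c"
  shows "unif ^ (k + 1) dvd
    poly (f (k + 1)) (of_nat s) - (poly (f (k + 1)) (of_nat n) + c * (of_nat s - of_nat n))"
proof -
  let ?f = "f (k + 1)" and ?n = "of_nat n :: 'p padic_int"
  define h where "h = of_nat s - ?n"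
  have "unif ^ (k + 1) dvd (unif ^ k)\<^sup>2"
    using assms(1) unfolding power_mult[symmetric] by (intro le_imp_power_dvd) simp
  also have "\<dots> dvd h\<^sup>2"
    using assms(3) by (simp add: h_def dvd_power_same)
  also have "\<dots> dvd poly ?f (?n + h) - poly ?f ?n - h * poly (pderiv ?f) ?n"
    by (rule second_order_taylor_poly)
  finally have 1: "unif ^ (k + 1) dvd \<dots>" .
  have "unif dvd poly (pderiv ?f) ?n - poly (pderiv (f 2)) ?n"
    using assms by (intro pderiv_cong) auto
  from dvd_add[OF this assms(4)] have "unif dvd poly (pderiv ?f) ?n - c" by simp
  with assms(3) have "unif ^ k * unif dvd h * (poly (pderiv ?f) ?n - c)"
    unfolding h_def by (rule mult_dvd_mono)
  then have 2: "unif ^ (k + 1) dvd h * (poly (pderiv ?f) ?n - c)" by (simp add: mult.commute)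
  from dvd_add[OF 1 2] show ?thesis by (simp add: h_def algebra_simps)
qed

text \<open>Uniqueness as in Hensel's lemma: the difference of the two values is h = s' - s times a
  factor that is a unit, so h inherits the divisibility.\<close>

lemma root_unique:
  assumes "j \<ge> 2" "s \<in> S" "unif dvd (of_nat s' - of_nat s :: 'p padic_int)"
    and unit: "poly (pderiv (f 2)) (of_nat s) dvd 1"
    and "unif ^ i dvd poly (f j) (of_nat s)" "unif ^ i dvd poly (f j) (of_nat s')"
  shows "unif ^ i dvd (of_nat s' - of_nat s :: 'p padic_int)"
proof -
  let ?s = "of_nat s :: 'p padic_int"
  define h where "h = of_nat s' - ?s"
  obtain r where r: "poly (f j) (?s + h) - poly (f j) ?s - h * poly (pderiv (f j)) ?s = h\<^sup>2 * r"
    using second_order_taylor_poly[of h "f j" ?s] by (auto elim: dvdE)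
  let ?u = "poly (pderiv (f j)) ?s + h * r"
  \<comment> \<open>Since p divides h, the factor \<open>?u\<close> reduces modulo p to the
    derivative of \<open>f 2\<close> at \<open>s\<close>, a unit by assumption.\<close>
  have "unif dvd h * r + (poly (pderiv (f j)) ?s - poly (pderiv (f 2)) ?s)"
    using assms(3) by (intro dvd_add pderiv_cong assms) (auto simp: h_def)
  then have "unif dvd ?u - poly (pderiv (f 2)) ?s" by (simp add: algebra_simps)
  then have "?u dvd 1" using unit dvd_diff_cong unfolding padic_int_unit_iff by blast
  moreover have "unif ^ i dvd poly (f j) (?s + h) - poly (f j) ?s"
    using assms by (intro dvd_diff) (simp_all add: h_def)
  moreover have "poly (f j) (?s + h) - poly (f j) ?s = h * ?u"
    using r by (simp add: algebra_simps power2_eq_square)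
  ultimately show ?thesis by (simp add: dvd_mult_unit_cancel h_def)
qed

text \<open>Multiplying the linear approximation by the unit \<open>v * g\<close> turns its zero into Newton's
  iterate.\<close>

lemma dvd_a_iff_newton:
  assumes "k \<ge> 1" "n \<in> S" "s \<in> S" "unif ^ k dvd (of_nat s - of_nat n :: 'p padic_int)"
    and "unif dvd poly (pderiv (f 2)) (of_nat n) - c"
    and v: "v * (g (k + 1) n * c) = 1"
  shows "unif ^ (k + 1) dvd a s \<longleftrightarrow> unif ^ (k + 1) dvd of_nat s - (of_nat n - a n * v)"
proof -
  let ?P = "\<lambda>x :: 'p padic_int. unif ^ (k + 1) dvd x"
  let ?F = "poly (f (k + 1)) (of_nat n)" and ?d = "of_nat s - of_nat n :: 'p padic_int"
  have vg: "v * g (k + 1) n dvd 1" using v by (metis dvd_triv_left mult.assoc)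
  have "?P (a s) \<longleftrightarrow> ?P (poly (f (k + 1)) (of_nat s))"
    using assms by (intro dvd_a_iff) auto
  also have "\<dots> \<longleftrightarrow> ?P (?F + c * ?d)"
    using linear_approx[OF assms(1,2,4,5)] by (rule dvd_diff_cong)
  also have "\<dots> \<longleftrightarrow> ?P ((?F + c * ?d) * (v * g (k + 1) n))"
    by (rule dvd_mult_unit_cancel[OF vg, symmetric])
  also have "(?F + c * ?d) * (v * g (k + 1) n)
      = ?F * g (k + 1) n * v + ?d * (v * (g (k + 1) n * c))"
    by (simp add: algebra_simps)
  also have "\<dots> = ?F * g (k + 1) n * v + ?d"
    unfolding v by simp
  also have "?P \<dots> \<longleftrightarrow> ?P (of_nat s - (of_nat n - a n * v))"
  proof (rule dvd_diff_cong)
    \<comment> \<open>Modulo \<open>unif ^ (k + 1)\<close> the product of \<open>?F\<close> and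
      \<open>g (k + 1) n\<close> may be replaced by \<open>a n\<close>.\<close>
    have "?P ((a n - ?F * g (k + 1) n) * (- v))"
      using assms by (intro dvd_mult2 a_cong) auto
    then show "?P (?F * g (k + 1) n * v + ?d - (of_nat s - (of_nat n - a n * v)))"
      by (simp add: algebra_simps)
  qed
  finally show ?thesis .
qed

lemma dvd_a_shift:
  assumes "k \<ge> 1" "n \<in> S" "s \<in> S" "unif ^ k dvd (of_nat s - of_nat n :: 'p padic_int)"
    and "unif ^ k dvd a n"
  shows "unif ^ k dvd a s"
proof -
  \<comment> \<open>The index is \<open>k + 1\<close> because decompositions start at 2, while
    \<open>k\<close> may be 1.\<close>
  have "unif ^ k dvd poly (f (k + 1)) (of_nat s) - poly (f (k + 1)) (of_nat n)"
    using assms(4) dvd_poly_diff by (rule dvd_trans)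
  from dvd_diff_cong[OF this] show ?thesis
    using assms dvd_a_iff[of "k + 1" n k] dvd_a_iff[of "k + 1" s k] by simp
qed

end

section \<open>Existence, uniqueness and Newton congruence of lifts at a simple root\<close>

lemma is_lift_iff:
  "is_lift a S n0 k l m \<longleftrightarrow>
     unif ^ k dvd (of_nat m - of_nat n0 :: 'p padic_int) \<and>
     (\<forall>n\<in>S. unif ^ l dvd (of_nat n - of_nat m :: 'p padic_int) \<longrightarrow> unif ^ l dvd a n)"
  for a :: "nat \<Rightarrow> 'p::prime_card padic_int"
  by (simp add: is_lift_def padic_val_to_fract_ge_iff cong_iff_unif_power_dvd[where 'p = 'p])

text \<open>The exponent \<open>e\<close> of the fixed class of \<open>n0\<close> is separate from
  the level \<open>k\<close> of the lemmas below: part (1) takes \<open>e\<close> equal to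
  \<open>k\<close>, the final part takes 1 and lets the level grow. The unit \<open>c\<close> is q
  as a p-adic integer, and \<open>dense\<close> is density in terms of congruences.\<close>

locale pseudo_poly_simple_root = pseudo_poly a S f g
  for a :: "nat \<Rightarrow> 'p::prime_card padic_int" and S f g +
  fixes n0 e :: nat and c
  assumes n0: "n0 \<in> S" and e: "e \<ge> 1"
    and c_unit: "c dvd 1"
    and c_cong: "unif dvd poly (pderiv (f 2)) (of_nat n0) - c"
    and dense: "\<And>n l. [n = n0] (mod CARD('p) ^ e) \<Longrightarrow> \<exists>s\<in>S. [s = n] (mod CARD('p) ^ l)"
begin

lemma dvd_unif_power_trans:
  assumes "unif ^ l dvd (x - y :: 'p padic_int)" "unif ^ i dvd y - z" "i \<le> l"
  shows "unif ^ i dvd x - z"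
  using dvd_add[OF power_le_dvd[OF assms(1,3)] assms(2)] by simp

lemma unif_dvd_of_power:
  "unif ^ e dvd (x :: 'p padic_int) \<Longrightarrow> unif dvd x"
  using power_le_dvd[OF _ e, of unif x] by simp

lemma c_cong_class:
  assumes "n \<in> S" "unif dvd (of_nat n - of_nat n0 :: 'p padic_int)"
  shows "unif dvd poly (pderiv (f 2)) (of_nat n) - c"
  using dvd_add[OF pderiv_cong[OF order.refl assms] c_cong] by simp

lemma pderiv_unit:
  assumes "n \<in> S" "unif dvd (of_nat n - of_nat n0 :: 'p padic_int)"
  shows "poly (pderiv (f 2)) (of_nat n) dvd 1"
  using c_unit unfolding padic_int_unit_iff dvd_diff_cong[OF c_cong_class[OF assms]] .

lemma newton_inverse:
  assumes "k \<ge> 1" "n \<in> S"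
  obtains v where "v * (g (k + 1) n * c) = 1"
proof -
  have "g (k + 1) n dvd 1" using assms by (intro g_unit) auto
  then have "g (k + 1) n * c dvd 1" using c_unit by (metis mult_dvd_mono mult_1)
  then show thesis using that by (metis dvdE mult.commute)
qed

text \<open>Density gives a point \<open>s\<close> of \<open>S\<close> in the class of
  \<open>m\<close>. There \<open>unif ^ (k + 1)\<close> divides \<open>a s\<close>, so the Newton
  criterion applies to \<open>s\<close> and carries over to \<open>m\<close>.\<close>

lemma is_lift_newton:
  assumes "k \<ge> 1" "n \<in> S" "unif ^ e dvd (of_nat n - of_nat n0 :: 'p padic_int)"
    and "unif ^ k dvd a n" and m: "is_lift a S n0 e (k + 1) m"
    and v: "v * (g (k + 1) n * c) = 1"
  shows "unif ^ (k + 1) dvd of_nat m - (of_nat n - a n * v)"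
proof -
  have m0: "unif ^ e dvd (of_nat m - of_nat n0 :: 'p padic_int)"
    using m by (simp add: is_lift_iff)
  then obtain s where s: "s \<in> S" "unif ^ (k + 1) dvd (of_nat s - of_nat m :: 'p padic_int)"
    using dense[of m "k + 1"] unfolding cong_iff_unif_power_dvd[where 'p = 'p] by blast
  with m have as: "unif ^ (k + 1) dvd a s" by (auto simp: is_lift_iff)
  have n1: "unif dvd (of_nat n - of_nat n0 :: 'p padic_int)"
    using assms(3) by (rule unif_dvd_of_power)
  have "unif dvd (of_nat s - of_nat m :: 'p padic_int)" using s(2) by (auto intro: dvd_mult_left)
  moreover have "unif dvd (of_nat m - of_nat n0 :: 'p padic_int)"
    using m0 by (rule unif_dvd_of_power)
  moreover have "unif dvd (of_nat n0 - of_nat n :: 'p padic_int)"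
    using n1 by (simp add: dvd_diff_swap)
  ultimately have "unif dvd (of_nat s - of_nat m + (of_nat m - of_nat n0)
      + (of_nat n0 - of_nat n) :: 'p padic_int)"
    by (intro dvd_add)
  then have sn: "unif dvd (of_nat s - of_nat n :: 'p padic_int)" by simp
  \<comment> \<open>So far \<open>s\<close> and \<open>n\<close> are known to agree modulo p; as
    approximate roots of the same \<open>f (k + 1)\<close> they agree modulo
    \<open>unif ^ k\<close>, the precision that the Newton criterion asks for.\<close>
  have "unif ^ k dvd a s" using as by (auto intro: dvd_mult_right)
  then have "unif ^ k dvd (of_nat s - of_nat n :: 'p padic_int)"
    using assms s(1) dvd_a_iff[of "k + 1" n k] dvd_a_iff[of "k + 1" s k]
    by (intro root_unique[of "k + 1"] sn pderiv_unit n1) auto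
  then have sv: "unif ^ (k + 1) dvd of_nat s - (of_nat n - a n * v)"
    using as dvd_a_iff_newton[OF assms(1,2) s(1) _ c_cong_class[OF assms(2) n1] v] by blast
  from dvd_unif_power_trans[OF s(2)[THEN dvd_diff_swap[THEN iffD1]] sv] show ?thesis by simp
qed

text \<open>The witness is a natural number close to the Newton iterate of \<open>n\<close>. As
  \<open>unif ^ k\<close> divides \<open>a n\<close>, the iterate stays in the class of
  \<open>n\<close> modulo \<open>unif ^ k\<close>, where the linear approximation holds.\<close>

lemma is_lift_exists:
  assumes "k \<ge> 1" "e \<le> k" "n \<in> S" "unif ^ e dvd (of_nat n - of_nat n0 :: 'p padic_int)"
    and "unif ^ k dvd a n"
  shows "\<exists>m. is_lift a S n0 e (k + 1) m"
proof -
  obtain v where v: "v * (g (k + 1) n * c) = 1" using newton_inverse assms by blast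
  obtain m where m: "unif ^ (k + 1) dvd (of_nat n - a n * v) - of_nat m"
    using padic_int_approx_nat .
  have "unif ^ k dvd (of_nat n - a n * v) - of_nat n"
    using assms(5) by simp
  from dvd_unif_power_trans[OF m[THEN dvd_diff_swap[THEN iffD1]] this]
  have mn: "unif ^ k dvd (of_nat m - of_nat n :: 'p padic_int)" by simp
  have "unif ^ (k + 1) dvd a s"
    if s: "s \<in> S" "unif ^ (k + 1) dvd (of_nat s - of_nat m :: 'p padic_int)" for s
  proof -
    have "unif ^ k dvd (of_nat s - of_nat n :: 'p padic_int)"
      using s(2) mn by (rule dvd_unif_power_trans) simp
    moreover have "unif ^ (k + 1) dvd of_nat s - (of_nat n - a n * v)"
      using s(2) m[THEN dvd_diff_swap[THEN iffD1]] by (rule dvd_unif_power_trans) simp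
    moreover have "unif dvd poly (pderiv (f 2)) (of_nat n) - c"
      using assms unif_dvd_of_power by (intro c_cong_class)
    ultimately show ?thesis
      using dvd_a_iff_newton assms(1,3) s(1) v by blast
  qed
  moreover have "unif ^ e dvd (of_nat m - of_nat n0 :: 'p padic_int)"
    using mn assms(4,2) by (rule dvd_unif_power_trans)
  ultimately show ?thesis unfolding is_lift_iff by blast
qed

text \<open>Both lifts are congruent to the same Newton iterate of \<open>n\<close>.\<close>

lemma is_lift_unique:
  assumes "k \<ge> 1" "n \<in> S" "unif ^ e dvd (of_nat n - of_nat n0 :: 'p padic_int)"
    and "unif ^ k dvd a n"
    and "is_lift a S n0 e (k + 1) m" "is_lift a S n0 e (k + 1) m'"
  shows "[m' = m] (mod CARD('p) ^ (k + 1))"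
proof -
  obtain v where v: "v * (g (k + 1) n * c) = 1" using newton_inverse assms by blast
  note newton = is_lift_newton[OF assms(1-4) _ v]
  from dvd_unif_power_trans[OF newton[OF assms(6)]
      newton[OF assms(5), THEN dvd_diff_swap[THEN iffD1]]]
  show ?thesis unfolding cong_iff_unif_power_dvd[where 'p = 'p] by simp
qed

text \<open>The inverse \<open>v\<close> in the ring becomes the quotient in the field.\<close>

lemma is_lift_padic_cong:
  assumes "k \<ge> 1" "n \<in> S" "unif ^ e dvd (of_nat n - of_nat n0 :: 'p padic_int)"
    and "unif ^ k dvd a n" and "is_lift a S n0 e (k + 1) m"
  shows "padic_cong (of_nat m)
    (of_nat n - to_fract (a n) / (to_fract (g (k + 1) n) * to_fract c)) (k + 1)"
proof -
  obtain v where v: "v * (g (k + 1) n * c) = 1" using newton_inverse assms by blast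
  then have "to_fract v * (to_fract (g (k + 1) n) * to_fract c) = 1"
    by (metis to_fract_1 to_fract_mult)
  then have "to_fract v = inverse (to_fract (g (k + 1) n) * to_fract c)"
    by (metis inverse_unique mult.commute)
  then have "of_nat n - to_fract (a n) / (to_fract (g (k + 1) n) * to_fract c)
      = to_fract (of_nat n - a n * v)"
    by (simp add: to_fract_diff divide_inverse)
  moreover have "padic_cong (to_fract (of_nat m)) (to_fract (of_nat n - a n * v)) (k + 1)"
    unfolding padic_cong_to_fract_iff by (rule is_lift_newton[OF assms v])
  ultimately show ?thesis by simp
qed

lemma is_lift_1_base:
  assumes "e = 1" "unif dvd a n0"
  shows "is_lift a S n0 e 1 n0"
  using dvd_a_shift[of 1 n0] n0 assms by (auto simp: is_lift_iff)

lemma is_lift_exists_unique: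
  assumes "e = 1" "unif dvd a n0" "l \<ge> 1"
  shows "\<exists>m. is_lift a S n0 e l m \<and> (\<forall>m'. is_lift a S n0 e l m' \<longrightarrow> [m' = m] (mod CARD('p) ^ l))"
  using \<open>l \<ge> 1\<close>
proof (induction l rule: dec_induct)
  case base
  \<comment> \<open>At level 1 uniqueness is part of the definition of a lift.\<close>
  have "[m' = n0] (mod CARD('p) ^ 1)" if "is_lift a S n0 e 1 m'" for m'
    using that \<open>e = 1\<close> by (simp add: is_lift_def)
  with is_lift_1_base[OF assms(1,2)] show ?case by blast
next
  case (step l)
  then obtain m where m: "is_lift a S n0 e l m" by blast
  then have "[m = n0] (mod CARD('p) ^ e)" by (simp add: is_lift_def)
  \<comment> \<open>The lift \<open>m\<close> may lie outside \<open>S\<close>, where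
    \<open>g\<close> is unspecified; \<open>s\<close> represents the same class inside
    \<open>S\<close> and starts the next Newton step.\<close>
  from dense[OF this] obtain s where s: "s \<in> S"
    "unif ^ l dvd (of_nat s - of_nat m :: 'p padic_int)"
    unfolding cong_iff_unif_power_dvd[where 'p = 'p] by blast
  have "unif ^ l dvd a s" using m s by (auto simp: is_lift_iff)
  moreover have "unif ^ e dvd (of_nat s - of_nat n0 :: 'p padic_int)"
    using s(2) m[unfolded is_lift_iff, THEN conjunct1]
    by (rule dvd_unif_power_trans) (use step.hyps assms(1) in simp)
  ultimately show ?case
    using is_lift_exists[of l s] is_lift_unique[of l s] step.hyps s(1) assms(1) by auto
qed

end

section \<open>The difference quotient q as a derivative modulo p\<close>

lemma (in pseudo_poly) difference_quotient:
  assumes "n \<in> S" "n + CARD('p) \<in> S"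
    and q: "q = 1 / of_nat CARD('p) * (to_fract (a (n + CARD('p))) / to_fract (g 2 (n + CARD('p)))
                              - to_fract (a n) / to_fract (g 2 n))"
  obtains c where "q = to_fract c" "unif dvd poly (pderiv (f 2)) (of_nat n) - c"
proof -
  \<comment> \<open>As \<open>g 2 m\<close> is a unit, the quotient in the field is already a p-adic
    integer, congruent to the value of \<open>f 2\<close> modulo the square of p.\<close>
  have quot: "\<exists>b. to_fract (a m) / to_fract (g 2 m) = to_fract b \<and>
      unif ^ 2 dvd b - poly (f 2) (of_nat m)" if m: "m \<in> S" for m
  proof -
    obtain w where w: "1 = g 2 m * w" using g_unit[of 2 m] m by (auto elim: dvdE)
    then have "to_fract (g 2 m) * to_fract w = 1" by (metis to_fract_1 to_fract_mult)
    then have "to_fract (a m) / to_fract (g 2 m) = to_fract (a m * w)"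
      by (metis divide_inverse inverse_unique to_fract_mult)
    moreover have "unif ^ 2 dvd (a m - poly (f 2) (of_nat m) * g 2 m) * w"
      using a_cong[of 2 m] m by simp
    then have "unif ^ 2 dvd a m * w - poly (f 2) (of_nat m) * (g 2 m * w)"
      by (simp add: algebra_simps)
    then have "unif ^ 2 dvd a m * w - poly (f 2) (of_nat m)"
      unfolding w[symmetric] by simp
    ultimately show ?thesis by blast
  qed
  let ?F = "poly (f 2)" and ?D = "poly (pderiv (f 2)) (of_nat n)"
  obtain b where b: "to_fract (a n) / to_fract (g 2 n) = to_fract b"
    "unif ^ 2 dvd b - ?F (of_nat n)" using quot assms by blast
  obtain b' where b': "to_fract (a (n + CARD('p))) / to_fract (g 2 (n + CARD('p))) = to_fract b'"
    "unif ^ 2 dvd b' - ?F (of_nat (n + CARD('p)))" using quot assms by blast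
  have "unif ^ 2 dvd ?F (of_nat n + unif) - ?F (of_nat n) - unif * ?D"
    by (rule second_order_taylor_poly)
  with b'(2) have "unif ^ 2 dvd b' - ?F (of_nat (n + CARD('p)))
      + (?F (of_nat n + unif) - ?F (of_nat n) - unif * ?D)"
    by (rule dvd_add)
  from dvd_diff[OF this b(2)] have *: "unif ^ 2 dvd b' - b - unif * ?D"
    by (simp add: algebra_simps)
  \<comment> \<open>Reducing modulo p shows that p divides \<open>b' - b\<close>, which yields
    \<open>c\<close>; cancelling one p from the congruence modulo its square then compares
    \<open>c\<close> with the derivative.\<close>
  then have "unif dvd b' - b - unif * ?D"
    by (metis dvd_mult_left power2_eq_square)
  from dvd_diff_cong[OF this] have "unif dvd b' - b" by simp
  then obtain c where c: "b' - b = unif * c" by (auto elim: dvdE)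
  have "unif * unif dvd unif * (c - ?D)"
    using * unfolding c by (simp add: power2_eq_square algebra_simps)
  then have "unif dvd ?D - c" by (simp add: dvd_diff_swap)
  moreover have "q = to_fract c"
  proof -
    have "q = 1 / of_nat CARD('p) * to_fract (b' - b)"
      unfolding q b(1) b'(1) by (simp add: to_fract_diff)
    then show ?thesis unfolding c by simp
  qed
  ultimately show thesis using that by blast
qed

text \<open>Since \<open>g\<close> has domain \<open>S\<close>, the point
  \<open>n\<^sub>k + p\<close> in q is taken from \<open>S\<close>, and in the final congruence
  every representative \<open>n\<close> in \<open>S\<close> of the previous lift is allowed.\<close>

theorem theorem1:
  fixes a :: "nat \<Rightarrow> 'p::prime_card padic_int"
    and S :: "nat set"
    and f :: "nat \<Rightarrow> 'p padic_int poly"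
    and g :: "nat \<Rightarrow> nat \<Rightarrow> 'p padic_int"
    and p k n\<^sub>k :: nat
    and q :: "'p padic"
  assumes p: "p = CARD('p)"
    and k: "k > 0"
    and decomp: "pseudo_poly_decomposition a S f g"
    and nk: "n\<^sub>k \<in> S" "n\<^sub>k + p \<in> S"
    and dvd: "ereal (real k) \<le> padic_val (to_fract (a n\<^sub>k))"
    and q: "q = 1 / of_nat p * (to_fract (a (n\<^sub>k + p)) / to_fract (g 2 (n\<^sub>k + p))
                              - to_fract (a n\<^sub>k) / to_fract (g 2 n\<^sub>k))"
  shows
    "(padic_val q = 0 \<and>
      (of_nat ` {n. [n = n\<^sub>k] (mod p ^ k)} :: 'p padic set)
        \<subseteq> padic_topology closure_of (of_nat ` S)
      \<longrightarrow> (\<exists>m. is_lift a S n\<^sub>k k (k + 1) m \<and>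
              (\<forall>m'. is_lift a S n\<^sub>k k (k + 1) m' \<longrightarrow> [m' = m] (mod p ^ (k + 1)))) \<and>
          (\<forall>m. is_lift a S n\<^sub>k k (k + 1) m \<longrightarrow>
              padic_cong (of_nat m)
                (of_nat n\<^sub>k - to_fract (a n\<^sub>k) / (to_fract (g (k + 1) n\<^sub>k) * q)) (k + 1)))
   \<and> (padic_val q > 0 \<and> ereal (real (k + 1)) \<le> padic_val (to_fract (a n\<^sub>k))
      \<longrightarrow> (\<forall>n\<in>S. [n = n\<^sub>k] (mod p ^ k) \<longrightarrow>
              ereal (real (k + 1)) \<le> padic_val (to_fract (a n))))
   \<and> (padic_val q > 0 \<and> \<not> ereal (real (k + 1)) \<le> padic_val (to_fract (a n\<^sub>k))
      \<longrightarrow> (\<forall>n\<in>S. [n = n\<^sub>k] (mod p ^ k) \<longrightarrow>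
              \<not> ereal (real (k + 1)) \<le> padic_val (to_fract (a n))))
   \<and> (k = 1 \<and> padic_val q = 0 \<and>
      (of_nat ` {n. [n = n\<^sub>k] (mod p)} :: 'p padic set)
        \<subseteq> padic_topology closure_of (of_nat ` S)
      \<longrightarrow> (\<forall>l\<ge>1. \<exists>m. is_lift a S n\<^sub>k 1 l m \<and>
              (\<forall>m'. is_lift a S n\<^sub>k 1 l m' \<longrightarrow> [m' = m] (mod p ^ l))) \<and>
          (\<forall>l>1. \<forall>n\<in>S. \<forall>m. is_lift a S n\<^sub>k 1 (l - 1) n \<and> is_lift a S n\<^sub>k 1 l m \<longrightarrow>
              padic_cong (of_nat m)
                (of_nat n - to_fract (a n) / (to_fract (g l n) * q)) l))"
proof -
  interpret pseudo_poly a S f g by unfold_locales (rule decomp)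
  obtain c where c: "q = to_fract c" and c_cong: "unif dvd poly (pderiv (f 2)) (of_nat n\<^sub>k) - c"
    using difference_quotient nk q unfolding p by metis
  have ank: "unif ^ k dvd a n\<^sub>k" using dvd by (simp add: padic_val_to_fract_ge_iff)
  \<comment> \<open>Stated for every \<open>e\<close>, to serve both part (1) and the final
    part.\<close>
  have simple_root: "pseudo_poly_simple_root a S f g n\<^sub>k e c"
    if "e \<ge> 1" "padic_val q = 0"
      and sub: "(of_nat ` {n. [n = n\<^sub>k] (mod CARD('p) ^ e)} :: 'p padic set)
        \<subseteq> padic_topology closure_of (of_nat ` S)" for e
  proof unfold_locales
    fix n l
    assume "[n = n\<^sub>k] (mod CARD('p) ^ e)"
    then have "(of_nat n :: 'p padic) \<in> padic_topology closure_of (of_nat ` S)" using sub by blast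
    then show "\<exists>s\<in>S. [s = n] (mod CARD('p) ^ l)" by (metis padic_closure_of_approx)
  qed (use that nk c c_cong padic_val_to_fract_eq_0_iff in auto)
  have same: "unif ^ (k + 1) dvd a n \<longleftrightarrow> unif ^ (k + 1) dvd a n\<^sub>k"
    if "padic_val q > 0" "n \<in> S" "[n = n\<^sub>k] (mod CARD('p) ^ k)" for n
  proof -
    have "unif dvd c" using that c padic_val_to_fract_pos_iff by blast
    \<comment> \<open>With p dividing \<open>c\<close>, the slope can be taken to be 0, and the
      linear approximation becomes constant on the class.\<close>
    then have "unif dvd poly (pderiv (f 2)) (of_nat n\<^sub>k) - 0"
      using dvd_diff_cong[OF c_cong] by simp
    moreover have "unif ^ k dvd (of_nat n - of_nat n\<^sub>k :: 'p padic_int)"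
      using that cong_iff_unif_power_dvd by blast
    ultimately have "unif ^ (k + 1) dvd
        poly (f (k + 1)) (of_nat n) - (poly (f (k + 1)) (of_nat n\<^sub>k) + 0 * (of_nat n - of_nat n\<^sub>k))"
      using k nk by (intro linear_approx) auto
    from dvd_diff_cong[OF this] show ?thesis
      using k nk that dvd_a_iff[of "k + 1" n "k + 1"] dvd_a_iff[of "k + 1" n\<^sub>k "k + 1"] by simp
  qed
  show ?thesis unfolding p
  proof (intro conjI impI)
    assume A: "padic_val q = 0 \<and> (of_nat ` {n. [n = n\<^sub>k] (mod CARD('p) ^ k)} :: 'p padic set)
        \<subseteq> padic_topology closure_of (of_nat ` S)"
    interpret pseudo_poly_simple_root a S f g n\<^sub>k k c
      using A k by (intro simple_root) auto
    show "\<exists>m. is_lift a S n\<^sub>k k (k + 1) m \<and>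
        (\<forall>m'. is_lift a S n\<^sub>k k (k + 1) m' \<longrightarrow> [m' = m] (mod CARD('p) ^ (k + 1)))"
      using is_lift_exists[of k n\<^sub>k] is_lift_unique[of k n\<^sub>k] k nk ank by auto
    show "\<forall>m. is_lift a S n\<^sub>k k (k + 1) m \<longrightarrow> padic_cong (of_nat m)
        (of_nat n\<^sub>k - to_fract (a n\<^sub>k) / (to_fract (g (k + 1) n\<^sub>k) * q)) (k + 1)"
      using is_lift_padic_cong[of k n\<^sub>k] k nk ank unfolding c by auto
  next
    assume "padic_val q > 0 \<and> ereal (real (k + 1)) \<le> padic_val (to_fract (a n\<^sub>k))"
    then show "\<forall>n\<in>S. [n = n\<^sub>k] (mod CARD('p) ^ k) \<longrightarrow>
        ereal (real (k + 1)) \<le> padic_val (to_fract (a n))"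
      using same unfolding padic_val_to_fract_ge_iff by blast
  next
    assume "padic_val q > 0 \<and> \<not> ereal (real (k + 1)) \<le> padic_val (to_fract (a n\<^sub>k))"
    then show "\<forall>n\<in>S. [n = n\<^sub>k] (mod CARD('p) ^ k) \<longrightarrow>
        \<not> ereal (real (k + 1)) \<le> padic_val (to_fract (a n))"
      using same unfolding padic_val_to_fract_ge_iff by blast
  next
    assume A: "k = 1 \<and> padic_val q = 0 \<and>
      (of_nat ` {n. [n = n\<^sub>k] (mod CARD('p))} :: 'p padic set)
        \<subseteq> padic_topology closure_of (of_nat ` S)"
    interpret pseudo_poly_simple_root a S f g n\<^sub>k 1 c
      using A by (intro simple_root) auto
    have "unif dvd a n\<^sub>k" using A ank by simp
    then show "\<forall>l\<ge>1. \<exists>m. is_lift a S n\<^sub>k 1 l m \<and>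
        (\<forall>m'. is_lift a S n\<^sub>k 1 l m' \<longrightarrow> [m' = m] (mod CARD('p) ^ l))"
      using is_lift_exists_unique by blast
    show "\<forall>l>1. \<forall>n\<in>S. \<forall>m. is_lift a S n\<^sub>k 1 (l - 1) n \<and> is_lift a S n\<^sub>k 1 l m \<longrightarrow>
        padic_cong (of_nat m) (of_nat n - to_fract (a n) / (to_fract (g l n) * q)) l"
    proof (intro allI ballI impI)
      fix l n m
      assume "1 < l" and n: "n \<in> S"
        and lift: "is_lift a S n\<^sub>k 1 (l - 1) n \<and> is_lift a S n\<^sub>k 1 l m"
      then obtain i where l: "l = i + 1" "i \<ge> 1"
        by (metis add.commute less_imp_add_positive less_eq_Suc_le One_nat_def)
      have "unif ^ i dvd a n" "unif ^ 1 dvd (of_nat n - of_nat n\<^sub>k :: 'p padic_int)"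
        using lift n by (auto simp: is_lift_iff l)
      then show "padic_cong (of_nat m) (of_nat n - to_fract (a n) / (to_fract (g l n) * q)) l"
        using is_lift_padic_cong[of i n m] l n lift unfolding c by auto
    qed
  qed
qed

end
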